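(* Every symmetric full-dimensional polytope in $\mathbb{R}^n$ is a generalized ellipsoid, and every intersection of finitely many co-centered ellipsoids in $\mathbb{R}^n$ is a generalized ellipsoid.
   Context: A set in $\mathbb{R}^n$ is symmetric if it is symmetric around some point (its center), i.e., after translating that point to the origin, $x$ belongs to the set if and only if $-x$ does. A polytope is a bounded polyhedron; it is full-dimensional if it has nonempty interior. An ellipsoid in $\mathbb{R}^n$ with center $x_0$ is a set $\{x\in\mathbb{R}^n\mid (x-x_0)^TP(x-x_0)\le 1\}$ with $P$ a (symmetric) positive definite matrix; ellipsoids are co-centered if they have the same center. A set $\mathcal{E}_d\subset\mathbb{R}^n$ is a generalized ellipsoid of degree $d$ if it can be written as $\mathcal{E}_d=\{x\in\mathbb{R}^n\mid (x-x_0)^TP(t)(x-x_0)\le 1\ \ \forall t\in[-1,1]\}$ for some vector $x_0\in\mathbb{R}^n$ and some univariate polynomial matrix $P(t)$ (a real symmetric $n\times n$ matrix whose entries are polynomials in $t$) of degree at most $d$ that satisfies $P(t)\succeq 0$ for all $t\in[-1,1]$ and $\bigcap_{t\in[-1,1]}\mathrm{Ker}(P(t))=\{0\}$. A set is a generalized ellipsoid if it is a generalized ellipsoid of degree $d$ for some nonnegative integer $d$. *)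

theory Defs
  imports "HOL-Analysis.Analysis" "HOL-Computational_Algebra.Polynomial"
begin

definition symmetric_around :: "real^'n \<Rightarrow> (real^'n) set \<Rightarrow> bool" where
  "symmetric_around c S \<longleftrightarrow>
     (\<forall>x. x \<in> (\<lambda>y. y - c) ` S \<longleftrightarrow> - x \<in> (\<lambda>y. y - c) ` S)"

definition symmetric_set :: "(real^'n) set \<Rightarrow> bool" where
  "symmetric_set S \<longleftrightarrow> (\<exists>c. symmetric_around c S)"

definition positive_semidefinite :: "real^'n^'n \<Rightarrow> bool" where
  "positive_semidefinite A \<longleftrightarrow> transpose A = A \<and> (\<forall>x. 0 \<le> x \<bullet> (A *v x))"

definition positive_definite :: "real^'n^'n \<Rightarrow> bool" where
  "positive_definite A \<longleftrightarrow> transpose A = A \<and> (\<forall>x. x \<noteq> 0 \<longrightarrow> 0 < x \<bullet> (A *v x))"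

definition ellipsoid_centered_at :: "real^'n \<Rightarrow> (real^'n) set \<Rightarrow> bool" where
  "ellipsoid_centered_at c E \<longleftrightarrow>
     (\<exists>P. positive_definite P \<and> E = {x. (x - c) \<bullet> (P *v (x - c)) \<le> 1})"

text \<open>A univariate polynomial matrix is represented by the matrix of its polynomial entries.\<close>

definition poly_mat_eval :: "(real poly)^'n^'n \<Rightarrow> real \<Rightarrow> real^'n^'n" where
  "poly_mat_eval P t = (\<chi> i j. poly (P $ i $ j) t)"

definition poly_mat_degree_le :: "(real poly)^'n^'n \<Rightarrow> nat \<Rightarrow> bool" where
  "poly_mat_degree_le P d \<longleftrightarrow> (\<forall>i j. degree (P $ i $ j) \<le> d)"

definition mat_ker :: "real^'n^'n \<Rightarrow> (real^'n) set" where
  "mat_ker A = {x. A *v x = 0}"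

definition generalized_ellipsoid_of_degree :: "nat \<Rightarrow> (real^'n) set \<Rightarrow> bool" where
  "generalized_ellipsoid_of_degree d E \<longleftrightarrow>
     (\<exists>(c :: real^'n) (P :: (real poly)^'n^'n).
        transpose P = P \<and> poly_mat_degree_le P d \<and>
        (\<forall>t\<in>{-1..1}. positive_semidefinite (poly_mat_eval P t)) \<and>
        (\<Inter>t\<in>{-1..1}. mat_ker (poly_mat_eval P t)) = {0} \<and>
        E = {x. \<forall>t\<in>{-1..1}. (x - c) \<bullet> (poly_mat_eval P t *v (x - c)) \<le> 1})"

definition generalized_ellipsoid :: "(real^'n) set \<Rightarrow> bool" where
  "generalized_ellipsoid E \<longleftrightarrow> (\<exists>d. generalized_ellipsoid_of_degree d E)"

end

theory Submission
  imports Defs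
begin

text \<open>
  Both classes of sets have the form \<open>{x. \<forall>A\<in>\<A>. (x - c) \<bullet> (A *v (x - c)) \<le> 1}\<close> for a finite
  set \<open>\<A>\<close> of positive semidefinite matrices with trivial common kernel. For ellipsoids this is the
  definition. In a symmetric polytope with interior the centre is an interior point, so every
  defining halfspace can be scaled to \<open>u \<bullet> (x - c) \<le> 1\<close>; by symmetry the opposite inequality
  holds as well, and the two together say \<open>(u \<bullet> (x - c))\<^sup>2 \<le> 1\<close>, which is a constraint given by
  the rank-one matrix of \<open>u\<close>. Boundedness makes the common kernel trivial.

  To merge finitely many matrices into one polynomial matrix, it suffices to find a polynomial
  curve \<open>P\<close> on \<open>[-1,1]\<close> that passes through every matrix of \<open>\<A>\<close> and never leaves the convex
  hull of \<open>\<A>\<close> (\<open>polynomial_curve_in_hull_through_finite_set\<close>). For fixed \<open>x\<close> the constraint is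
  linear in the matrix, so it holds on the convex hull as soon as it holds on \<open>\<A>\<close>; positive
  semidefiniteness passes to the convex hull for the same reason. Conversely the curve attains
  each member of \<open>\<A>\<close>, so no constraint is lost and the common kernel stays the same.

  The curve is built by adding one matrix at a time. If \<open>P\<close> passes through the matrices found so
  far at finitely many parameters, take a polynomial \<open>s\<close> with values in \<open>[0,1]\<close> that vanishes at
  these parameters and takes the value 1 somewhere (\<open>polynomial_bump\<close>). Then \<open>(1 - s) P + s A\<close>
  keeps the old values and also passes through \<open>A\<close>.
\<close>

section \<open>Polynomial curves through finitely many matrices\<close>

text \<open>
  The square of \<open>\<Prod>t\<in>N. (x - t)\<close>, divided by its maximum over the interval, does the job; the
  maximum is positive because an interval contains points outside the finite set \<open>N\<close>.
\<close>

lemma polynomial_bump: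
  fixes a b :: real
  assumes "a < b" and "finite N"
  obtains s where "\<And>t. t \<in> N \<Longrightarrow> poly s t = 0"
    and "\<And>t. t \<in> {a..b} \<Longrightarrow> 0 \<le> poly s t \<and> poly s t \<le> 1"
    and "\<exists>t\<in>{a..b}. poly s t = 1"
proof -
  define r :: "real poly" where "r = (\<Prod>t\<in>N. [:- t, 1:])\<^sup>2"
  have r: "poly r x = (\<Prod>t\<in>N. x - t)\<^sup>2" for x
    by (simp add: r_def poly_prod power2_eq_square)
  have "\<exists>m\<in>{a..b}. \<forall>t\<in>{a..b}. poly r t \<le> poly r m"
    using \<open>a < b\<close> by (intro continuous_attains_sup) (auto intro!: continuous_intros)
  then obtain m where m: "m \<in> {a..b}" "\<And>t. t \<in> {a..b} \<Longrightarrow> poly r t \<le> poly r m"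
    by blast
  have "\<not> {a..b} \<subseteq> N"
    using assms infinite_Icc finite_subset by blast
  then obtain z where z: "z \<in> {a..b}" "z \<notin> N" by blast
  then have "poly r z > 0"
    using \<open>finite N\<close> by (auto simp: r)
  with m(2)[OF z(1)] have pos: "poly r m > 0" by linarith
  show thesis
  proof (rule that[of "smult (1 / poly r m) r"])
    show "poly (smult (1 / poly r m) r) t = 0" if "t \<in> N" for t
    proof -
      have "poly r t = 0" using that \<open>finite N\<close> by (auto simp: r)
      then show ?thesis by simp
    qed
    show "0 \<le> poly (smult (1 / poly r m) r) t \<and> poly (smult (1 / poly r m) r) t \<le> 1"
      if "t \<in> {a..b}" for t
    proof -
      have "0 \<le> poly r t" by (simp add: r)
      then show ?thesis using m(2)[OF that] pos by simp
    qed
    show "\<exists>t\<in>{a..b}. poly (smult (1 / poly r m) r) t = 1"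
      using m(1) pos by (intro bexI[of _ m]) auto
  qed
qed

text \<open>
  The induction works because the bump vanishes at a parameter \<open>\<tau> B\<close> for each old matrix \<open>B\<close>, so
  these are still attained, and because its values in \<open>[0,1]\<close> make every new point of the curve a
  convex combination of an old point and the added matrix.
\<close>

lemma polynomial_curve_in_hull_through_finite_set:
  fixes \<A> :: "(real^'n^'n) set"
  assumes "finite \<A>" and "\<A> \<noteq> {}" and "\<And>A. A \<in> \<A> \<Longrightarrow> transpose A = A"
  shows "\<exists>P. transpose P = P \<and> (\<forall>t\<in>{-1..1}. poly_mat_eval P t \<in> convex hull \<A>) \<and>
             (\<forall>A\<in>\<A>. \<exists>t\<in>{-1..1}. poly_mat_eval P t = A)"
  using assms
proof (induction \<A> rule: finite_ne_induct)
  case (singleton A)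
  define P :: "(real poly)^'n^'n" where "P = (\<chi> i j. [:A $ i $ j:])"
  have "poly_mat_eval P t = A" for t
    by (simp add: P_def poly_mat_eval_def vec_eq_iff)
  moreover have "transpose A = A"
    using singleton by simp
  then have "transpose P = P"
    by (simp add: P_def transpose_def vec_eq_iff)
  ultimately show ?case
    by (intro exI[of _ P]) (auto intro!: bexI[of _ 0])
next
  case (insert A \<A>)
  then obtain P where P: "transpose P = P"
      "\<And>t. t \<in> {-1..1} \<Longrightarrow> poly_mat_eval P t \<in> convex hull \<A>"
      "\<forall>B\<in>\<A>. \<exists>t\<in>{-1..1}. poly_mat_eval P t = B"
    by (meson insertI2)
  from P(3) obtain \<tau> where \<tau>: "\<And>B. B \<in> \<A> \<Longrightarrow> \<tau> B \<in> {-1..1} \<and> poly_mat_eval P (\<tau> B) = B"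
    by metis
  obtain s where s: "\<And>t. t \<in> \<tau> ` \<A> \<Longrightarrow> poly s t = 0"
      "\<And>t. t \<in> {-1..1} \<Longrightarrow> 0 \<le> poly s t \<and> poly s t \<le> 1"
      "\<exists>t\<in>{-1..1}. poly s t = (1::real)"
    using polynomial_bump[of "-1" 1 "\<tau> ` \<A>"] insert.hyps(1) by auto
  define Q :: "(real poly)^'n^'n"
    where "Q = (\<chi> i j. (1 - s) * P $ i $ j + smult (A $ i $ j) s)"
  have Q: "poly_mat_eval Q t = (1 - poly s t) *\<^sub>R poly_mat_eval P t + poly s t *\<^sub>R A" for t
    by (simp add: Q_def poly_mat_eval_def vec_eq_iff algebra_simps)
  have "transpose A = A" using insert.prems by simp
  then have "transpose Q = Q"
    using P(1) by (simp add: Q_def transpose_def vec_eq_iff)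
  moreover have "poly_mat_eval Q t \<in> convex hull (insert A \<A>)" if "t \<in> {-1..1}" for t
  proof -
    have "poly_mat_eval P t \<in> convex hull (insert A \<A>)"
      using P(2)[OF that] hull_mono[of \<A> "insert A \<A>" convex] by blast
    moreover have "A \<in> convex hull (insert A \<A>)"
      by (simp add: hull_inc)
    ultimately show ?thesis
      unfolding Q using s(2)[OF that] by (intro convexD[OF convex_convex_hull]) auto
  qed
  moreover have "\<exists>t\<in>{-1..1}. poly_mat_eval Q t = B" if "B \<in> insert A \<A>" for B
  proof (cases "B \<in> \<A>")
    case True
    then show ?thesis
      using \<tau>[OF True] s(1)[of "\<tau> B"] by (intro bexI[of _ "\<tau> B"]) (auto simp: Q)
  next
    case False
    then show ?thesis
      using that s(3) by (force simp: Q)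
  qed
  ultimately show ?case
    by (intro exI[of _ Q]) blast
qed

section \<open>Finitely many quadratic constraints\<close>

lemma convex_positive_semidefinite: "convex {A :: real^'n^'n. positive_semidefinite A}"
proof (rule convexI)
  fix A B :: "real^'n^'n" and u v :: real
  assume AB: "A \<in> {A. positive_semidefinite A}" "B \<in> {A. positive_semidefinite A}"
    and uv: "0 \<le> u" "0 \<le> v" "u + v = 1"
  have "transpose (u *\<^sub>R A + v *\<^sub>R B) = u *\<^sub>R transpose A + v *\<^sub>R transpose B"
    by (simp add: transpose_def vec_eq_iff)
  then show "u *\<^sub>R A + v *\<^sub>R B \<in> {A. positive_semidefinite A}"
    using AB uv
    by (auto simp: positive_semidefinite_def matrix_vector_mult_add_rdistrib
        scaleR_matrix_vector_assoc[symmetric] inner_add_right)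
qed

lemma convex_quadratic_form_le:
  fixes x :: "real^'n"
  shows "convex {A :: real^'n^'n. x \<bullet> (A *v x) \<le> r}"
proof (rule convexI)
  fix A B :: "real^'n^'n" and u v :: real
  assume AB: "A \<in> {A. x \<bullet> (A *v x) \<le> r}" "B \<in> {A. x \<bullet> (A *v x) \<le> r}"
    and uv: "0 \<le> u" "0 \<le> v" "u + v = 1"
  have "u * (x \<bullet> (A *v x)) + v * (x \<bullet> (B *v x)) \<le> r"
    using AB uv by (intro convex_bound_le) auto
  then show "u *\<^sub>R A + v *\<^sub>R B \<in> {A. x \<bullet> (A *v x) \<le> r}"
    by (simp add: matrix_vector_mult_add_rdistrib
        scaleR_matrix_vector_assoc[symmetric] inner_add_right)
qed

lemma generalized_ellipsoid_finite_forms: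
  fixes \<A> :: "(real^'n^'n) set" and c :: "real^'n"
  assumes fin: "finite \<A>" and psd: "\<And>A. A \<in> \<A> \<Longrightarrow> positive_semidefinite A"
    and ker: "(\<Inter>A\<in>\<A>. mat_ker A) = {0}"
  shows "generalized_ellipsoid {x. \<forall>A\<in>\<A>. (x - c) \<bullet> (A *v (x - c)) \<le> 1}"
proof -
  have "(\<chi> i. 1) \<noteq> (0 :: real^'n)"
    by (simp add: vec_eq_iff)
  then have "\<A> \<noteq> {}"
    using ker by auto
  moreover have "transpose A = A" if "A \<in> \<A>" for A
    using psd[OF that] by (simp add: positive_semidefinite_def)
  ultimately obtain P where P: "transpose P = P"
      "\<And>t. t \<in> {-1..1} \<Longrightarrow> poly_mat_eval P t \<in> convex hull \<A>"
      "\<And>A. A \<in> \<A> \<Longrightarrow> \<exists>t\<in>{-1..1}. poly_mat_eval P t = A"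
    using polynomial_curve_in_hull_through_finite_set[OF fin] by metis
  have psdP: "positive_semidefinite (poly_mat_eval P t)" if "t \<in> {-1..1}" for t
  proof -
    have "convex hull \<A> \<subseteq> {A. positive_semidefinite A}"
      using psd by (intro hull_minimal convex_positive_semidefinite) auto
    with P(2)[OF that] show ?thesis by blast
  qed
  have "(\<Inter>t\<in>{-1..1}. mat_ker (poly_mat_eval P t)) \<subseteq> (\<Inter>A\<in>\<A>. mat_ker A)"
    using P(3) by force
  then have kerP: "(\<Inter>t\<in>{-1..1}. mat_ker (poly_mat_eval P t)) = {0}"
    unfolding ker by (auto simp: mat_ker_def)
  have le_iff: "(\<forall>A\<in>\<A>. y \<bullet> (A *v y) \<le> 1) \<longleftrightarrow>
      (\<forall>t\<in>{-1..1}. y \<bullet> (poly_mat_eval P t *v y) \<le> 1)" for y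
  proof
    assume "\<forall>A\<in>\<A>. y \<bullet> (A *v y) \<le> 1"
    then have "convex hull \<A> \<subseteq> {A. y \<bullet> (A *v y) \<le> 1}"
      by (intro hull_minimal convex_quadratic_form_le) auto
    with P(2) show "\<forall>t\<in>{-1..1}. y \<bullet> (poly_mat_eval P t *v y) \<le> 1" by blast
  next
    assume "\<forall>t\<in>{-1..1}. y \<bullet> (poly_mat_eval P t *v y) \<le> 1"
    with P(3) show "\<forall>A\<in>\<A>. y \<bullet> (A *v y) \<le> 1" by metis
  qed
  define d where "d = Max (range (\<lambda>(i, j). degree (P $ i $ j)))"
  have "degree (P $ i $ j) \<le> d" for i j
    unfolding d_def by (rule Max_ge) (auto intro: image_eqI[of _ _ "(i, j)"])
  then have "poly_mat_degree_le P d"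
    by (simp add: poly_mat_degree_le_def)
  then show ?thesis
    unfolding generalized_ellipsoid_def generalized_ellipsoid_of_degree_def
    using P(1) psdP kerP le_iff by blast
qed

section \<open>Symmetric polytopes\<close>

lemma symmetric_around_iff:
  "symmetric_around c S \<longleftrightarrow> (\<forall>y. c + y \<in> S \<longleftrightarrow> c - y \<in> S)"
proof -
  have "x \<in> (\<lambda>y. y - c) ` S \<longleftrightarrow> c + x \<in> S" for x
    by (force simp: image_iff algebra_simps)
  then show ?thesis
    by (simp add: symmetric_around_def)
qed

text \<open>
  The reflection in \<open>c\<close> turns a ball around an interior point \<open>p\<close> into a ball around \<open>2 c - p\<close>,
  and the midpoints of corresponding points of these balls fill a ball around \<open>c\<close>.
\<close>

lemma center_in_interior_of_convex:
  fixes S :: "(real^'n) set"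
  assumes "convex S" and "interior S \<noteq> {}" and sym: "symmetric_around c S"
  shows "c \<in> interior S"
proof -
  obtain p e where p: "e > 0" "ball p e \<subseteq> S"
    using assms(2) by (auto simp: mem_interior)
  have "ball c e \<subseteq> S"
  proof
    fix z assume z: "z \<in> ball c e"
    define y where "y = z - c"
    have "norm y < e" using z by (simp add: y_def dist_norm norm_minus_commute)
    then have "p + y \<in> S" and "c + (p - y - c) \<in> S"
      using p by (auto simp: dist_norm subset_eq)
    moreover from this(2) have "c - (p - y - c) \<in> S"
      using sym unfolding symmetric_around_iff by blast
    ultimately have "(1/2) *\<^sub>R (p + y) + (1/2) *\<^sub>R (c - (p - y - c)) \<in> S"
      by (intro convexD[OF \<open>convex S\<close>]) auto
    also have "(1/2) *\<^sub>R (p + y) + (1/2) *\<^sub>R (c - (p - y - c)) = z"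
      by (simp add: y_def vec_eq_iff field_simps)
    finally show "z \<in> S" .
  qed
  with p(1) show ?thesis by (auto simp: mem_interior)
qed

text \<open>
  A halfspace \<open>a \<bullet> x \<le> b\<close> with \<open>c\<close> in its interior has slack \<open>b - a \<bullet> c > 0\<close>; dividing by it
  makes the right-hand side 1 in coordinates centred at \<open>c\<close>.
\<close>

lemma polyhedron_unit_halfspaces:
  fixes S :: "(real^'n) set"
  assumes "polyhedron S" and "c \<in> interior S"
  obtains U where "finite U" and "\<And>y. c + y \<in> S \<longleftrightarrow> (\<forall>u\<in>U. u \<bullet> y \<le> 1)"
proof -
  obtain F where F: "finite F" "S = \<Inter>F" "\<And>h. h \<in> F \<Longrightarrow> \<exists>a b. a \<noteq> 0 \<and> h = {x. a \<bullet> x \<le> b}"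
    using assms(1) unfolding polyhedron_def by metis
  have "\<exists>u. \<forall>y. c + y \<in> h \<longleftrightarrow> u \<bullet> y \<le> 1" if h: "h \<in> F" for h
  proof -
    obtain a b where ab: "a \<noteq> 0" "h = {x. a \<bullet> x \<le> b}" using F(3)[OF h] by blast
    have "c \<in> interior h"
      using assms(2) interior_mono[of S h] F(2) h by blast
    then have "a \<bullet> c < b" using ab by simp
    then have "c + y \<in> h \<longleftrightarrow> ((1 / (b - a \<bullet> c)) *\<^sub>R a) \<bullet> y \<le> 1" for y
      by (simp add: ab inner_add_right field_simps)
    then show ?thesis by blast
  qed
  then obtain f where f: "\<And>h y. h \<in> F \<Longrightarrow> c + y \<in> h \<longleftrightarrow> f h \<bullet> y \<le> 1" by metis
  show thesis
    by (rule that[of "f ` F"]) (use F f in auto)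
qed

definition outer_square :: "real^'n \<Rightarrow> real^'n^'n" where
  "outer_square u = (\<chi> i j. u $ i * u $ j)"

lemma outer_square_mult: "outer_square u *v x = (u \<bullet> x) *\<^sub>R u"
  by (simp add: outer_square_def matrix_vector_mult_def inner_vec_def vec_eq_iff
      sum_distrib_right sum_distrib_left mult_ac)

lemma quadratic_form_outer_square: "x \<bullet> (outer_square u *v x) = (u \<bullet> x)\<^sup>2"
  by (simp add: outer_square_mult inner_commute power2_eq_square)

lemma positive_semidefinite_outer_square: "positive_semidefinite (outer_square u)"
  unfolding positive_semidefinite_def quadratic_form_outer_square
  by (simp add: outer_square_def transpose_def vec_eq_iff mult.commute)

lemma generalized_ellipsoid_symmetric_polytope:
  fixes S :: "(real^'n) set"
  assumes "polyhedron S" and "bounded S" and "interior S \<noteq> {}" and sym: "symmetric_around c S"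
  shows "generalized_ellipsoid S"
proof -
  have "c \<in> interior S"
    using assms center_in_interior_of_convex polyhedron_imp_convex by blast
  then obtain U where U: "finite U" "\<And>y. c + y \<in> S \<longleftrightarrow> (\<forall>u\<in>U. u \<bullet> y \<le> 1)"
    using polyhedron_unit_halfspaces[OF assms(1)] by blast
  have S_iff: "c + y \<in> S \<longleftrightarrow> (\<forall>u\<in>U. (u \<bullet> y)\<^sup>2 \<le> 1)" for y
  proof -
    have "c + y \<in> S \<longleftrightarrow> c + y \<in> S \<and> c + (- y) \<in> S"
      using sym unfolding symmetric_around_iff by simp
    also have "\<dots> \<longleftrightarrow> (\<forall>u\<in>U. \<bar>u \<bullet> y\<bar> \<le> 1)"
      unfolding U(2) by (auto simp: abs_le_iff)
    finally show ?thesis by (simp add: abs_square_le_1)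
  qed
  have "S = {x. \<forall>A\<in>outer_square ` U. (x - c) \<bullet> (A *v (x - c)) \<le> 1}"
    using S_iff[of "x - c" for x] by (auto simp: quadratic_form_outer_square)
  moreover have "(\<Inter>A\<in>outer_square ` U. mat_ker A) = {0}"
  proof -
    have "x = 0" if x: "\<And>u. u \<in> U \<Longrightarrow> outer_square u *v x = 0" for x
    proof (rule ccontr)
      assume "x \<noteq> 0"
      have "u \<bullet> x = 0" if "u \<in> U" for u
        using x[OF that] by (auto simp: outer_square_mult)
      \<comment> \<open>The whole line through \<open>c\<close> in direction \<open>x\<close> would lie in the bounded set \<open>S\<close>.\<close>
      then have line: "c + k *\<^sub>R x \<in> S" for k
        by (simp add: U(2))
      obtain B where B: "\<And>z. z \<in> S \<Longrightarrow> norm z \<le> B"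
        using \<open>bounded S\<close> by (auto simp: bounded_iff)
      define k where "k = (B + norm c + 1) / norm x"
      have "B + norm c + 1 \<le> norm (k *\<^sub>R x)"
        using \<open>x \<noteq> 0\<close> by (simp add: k_def)
      also have "\<dots> \<le> norm (c + k *\<^sub>R x) + norm c"
        using norm_triangle_ineq4[of "c + k *\<^sub>R x" c] by simp
      also have "\<dots> \<le> B + norm c"
        using B[OF line] by simp
      finally show False by simp
    qed
    then show ?thesis by (auto simp: mat_ker_def)
  qed
  ultimately show ?thesis
    using generalized_ellipsoid_finite_forms[of "outer_square ` U" c] U(1)
      positive_semidefinite_outer_square by auto
qed

section \<open>Co-centered ellipsoids\<close>

lemma positive_definite_imp_semidefinite:
  "positive_definite A \<Longrightarrow> positive_semidefinite A"
  unfolding positive_definite_def positive_semidefinite_def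
  by (metis inner_zero_left less_imp_le order_refl)

lemma mat_ker_positive_definite:
  assumes "positive_definite A"
  shows "mat_ker A = {0}"
proof -
  have "x = 0" if "A *v x = 0" for x
    using assms that unfolding positive_definite_def by (metis inner_zero_right less_irrefl)
  then show ?thesis by (auto simp: mat_ker_def)
qed

lemma generalized_ellipsoid_Inter_ellipsoids:
  fixes c :: "real^'n"
  assumes "finite F" and "F \<noteq> {}" and "\<And>E. E \<in> F \<Longrightarrow> ellipsoid_centered_at c E"
  shows "generalized_ellipsoid (\<Inter>F)"
proof -
  obtain M where M: "\<And>E. E \<in> F \<Longrightarrow> positive_definite (M E)"
      "\<And>E. E \<in> F \<Longrightarrow> E = {x. (x - c) \<bullet> (M E *v (x - c)) \<le> 1}"
    using assms(3) unfolding ellipsoid_centered_at_def by metis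
  have "\<Inter>F = {x. \<forall>A\<in>M ` F. (x - c) \<bullet> (A *v (x - c)) \<le> 1}"
    using M(2) by blast
  moreover have "(\<Inter>A\<in>M ` F. mat_ker A) = {0}"
    using M(1) \<open>F \<noteq> {}\<close> by (auto simp: mat_ker_positive_definite)
  moreover have "positive_semidefinite A" if "A \<in> M ` F" for A
    using that M(1) positive_definite_imp_semidefinite by blast
  ultimately show ?thesis
    using generalized_ellipsoid_finite_forms[of "M ` F" c] \<open>finite F\<close> by simp
qed

theorem corollary5p6:
  shows "(\<forall>S :: (real^'n) set.
            polyhedron S \<and> bounded S \<and> interior S \<noteq> {} \<and> symmetric_set S
              \<longrightarrow> generalized_ellipsoid S) \<and>
         (\<forall>(c :: real^'n) (F :: (real^'n) set set).
            finite F \<and> F \<noteq> {} \<and> (\<forall>E\<in>F. ellipsoid_centered_at c E)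
              \<longrightarrow> generalized_ellipsoid (\<Inter>F))"
  using generalized_ellipsoid_symmetric_polytope generalized_ellipsoid_Inter_ellipsoids
  unfolding symmetric_set_def by metis

end
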